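(* Let $\varphi(x_1,\ldots,x_n)$ be an expression and let $a_1,\ldots,a_n\in \mathrm{M}$ be a valuation with $|\varphi(a_1,\ldots,a_n)| = |a_i| = b$ computed over $\mathrm{M}$, where the variables are indexed so that $$|a_1|\le\cdots\le|a_{i-1}|<|a_i|=\cdots=|a_{i+r}|<|a_{i+r+1}|\le\cdots\le|a_n|$$ for some $r\ge 0$. Then: (1) $\varphi(a_1,\ldots,a_n)=\varphi(a_1',\ldots,a_{i-1}',a_i,\ldots,a_n)$ for any $a_1',\ldots,a_{i-1}'\in\mathrm{M}$ with $|a_j'|<b$ for all $j<i$ (in particular, changes of sign are allowed); (2) $\varphi(a_1,\ldots,a_n)=\varphi(a_1,\ldots,a_{i+r},a_{i+r+1}',\ldots,a_n')$ for any $a_{i+r+1}',\ldots,a_n'\in\mathrm{M}$ such that, for each $j>i+r$, $|a_j'|>b$ and $a_j'$ has the same sign as $a_j$.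
   Context: $\mathrm{M}$ denotes the set $\widehat{\mathbb{Z}}=(\mathbb{Z}\setminus\{0\})\cup\{-\infty,\infty\}$, totally ordered in the usual way, with $a\land b=\min(a,b)$, $a\lor b=\max(a,b)$ and $\lnot a=-a$ (with $-(\pm\infty)=\mp\infty$, $|\pm\infty|=\infty$). An expression is a propositional formula built from variables using only $\land,\lor,\lnot$ (no constants); $\varphi(a_1,\ldots,a_n)$ denotes its value in $\mathrm{M}$ when $x_j$ is assigned $a_j$. *)

theory Defs
  imports Main "HOL-Library.Extended"
begin

definition Zhat :: "int extended set" where
  "Zhat = {Fin k | k. k \<noteq> 0} \<union> {-\<infinity>, \<infinity>}"

fun ext_abs :: "int extended \<Rightarrow> int extended" where
  "ext_abs (Fin k) = Fin \<bar>k\<bar>"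
| "ext_abs \<infinity> = \<infinity>"
| "ext_abs (-\<infinity>) = \<infinity>"

text \<open>Only meaningful on \<^const>\<open>Zhat\<close>, where no element is zero.\<close>

definition same_sign :: "int extended \<Rightarrow> int extended \<Rightarrow> bool" where
  "same_sign x y \<longleftrightarrow> (0 < x \<longleftrightarrow> 0 < y)"

datatype (vars: 'v) expr =
    Var 'v
  | Neg "'v expr"
  | Conj "'v expr" "'v expr"
  | Disj "'v expr" "'v expr"

primrec val :: "('v \<Rightarrow> int extended) \<Rightarrow> 'v expr \<Rightarrow> int extended" where
  "val a (Var x) = a x"
| "val a (Neg p) = - val a p"
| "val a (Conj p q) = min (val a p) (val a q)"
| "val a (Disj p q) = max (val a p) (val a q)"

lemma uminus_in_Zhat: "x \<in> Zhat \<Longrightarrow> - x \<in> Zhat"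
  by (auto simp: Zhat_def)

lemma val_in_Zhat: "(\<And>x. x \<in> vars p \<Longrightarrow> a x \<in> Zhat) \<Longrightarrow> val a p \<in> Zhat"
  by (induction p) (auto simp: uminus_in_Zhat min_def max_def)

end

theory Submission
  imports Defs
begin

text \<open>
  Fix a threshold b. Collapsing all values of modulus less than b to a single class is a congruence
  for minimum, maximum and negation, and so is collapsing the values above b to one class and those
  below -b to another; this is because the classes are intervals, permuted by negation. Both
  perturbations of the valuation stay within classes, and \<plusminus>b form singleton classes in either case.
\<close>

text \<open>Induction on the expression carries compatibility from the variables to the root.
  Leaving \<open>R\<close> arbitrary lets both collapsing relations be plugged in directly, without
  forming a quotient.\<close>

lemma val_rel:
  assumes "\<And>x. x \<in> vars p \<Longrightarrow> R (a x) (a' x)"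
    and "\<And>x y. R x y \<Longrightarrow> R (- x) (- y)"
    and "\<And>x y x' y'. R x y \<Longrightarrow> R x' y' \<Longrightarrow> R (min x x') (min y y')"
    and "\<And>x y x' y'. R x y \<Longrightarrow> R x' y' \<Longrightarrow> R (max x x') (max y y')"
  shows "R (val a p) (val a' p)"
  using assms(1) by (induction p) (simp_all add: assms(2-4))

lemma ext_abs_less_iff: "ext_abs x < b \<longleftrightarrow> - b < x \<and> x < b"
  by (cases x; cases b) auto

lemma less_ext_abs_iff: "b < ext_abs x \<longleftrightarrow> b < x \<or> x < - b"
  by (cases x; cases b) auto

lemma ext_abs_nonneg: "0 \<le> ext_abs x"
  by (cases x) (auto simp: zero_extended_def)

lemma ext_abs_uminus: "ext_abs (- x) = ext_abs x"
  by (cases x) auto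

lemma uminus_less_uminus_iff: "- x < - y \<longleftrightarrow> y < x" for x y :: "int extended"
  by (cases x; cases y) auto

lemma uminus_nonpos: "0 \<le> b \<Longrightarrow> - b \<le> 0" for b :: "int extended"
  by (cases b) (auto simp: zero_extended_def)

lemma less_uminus_iff: "x < - y \<longleftrightarrow> y < - x" for x y :: "int extended"
  by (cases x; cases y) auto

text \<open>A value of modulus at least \<open>b\<close> lies outside the collapsed interval, and
  there related elements are equal.\<close>

lemma val_cong_small:
  assumes "\<And>x. x \<in> vars p \<Longrightarrow> a x = a' x \<or> ext_abs (a x) < b \<and> ext_abs (a' x) < b"
    and "b \<le> ext_abs (val a p)"
  shows "val a p = val a' p"
proof -
  define R where "R x y \<longleftrightarrow> x = y \<or> ext_abs x < b \<and> ext_abs y < b" for x y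
  have "R (val a p) (val a' p)"
  proof (rule val_rel)
    show "R (a x) (a' x)" if "x \<in> vars p" for x
      using assms(1)[OF that] by (simp add: R_def)
    show "R (- x) (- y)" if "R x y" for x y
      using that by (auto simp: R_def ext_abs_uminus)
    \<comment> \<open>An element outside the open interval from \<open>- b\<close> to
      \<open>b\<close> lies on one side of all of it, so it is the minimum against every member of
      the interval or against none.\<close>
    show "R (min x x') (min y y')" if "R x y" "R x' y'" for x y x' y'
      using that by (auto simp: R_def ext_abs_less_iff min_def)
    show "R (max x x') (max y y')" if "R x y" "R x' y'" for x y x' y'
      using that by (auto simp: R_def ext_abs_less_iff max_def)
  qed
  with assms(2) show ?thesis
    by (auto simp: R_def)
qed

text \<open>A value of modulus at most \<open>b\<close> belongs to neither outer class, which leaves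
  only equality.\<close>

lemma val_cong_large:
  assumes "\<And>x. x \<in> vars p \<Longrightarrow>
      a x = a' x \<or> b < ext_abs (a x) \<and> b < ext_abs (a' x) \<and> same_sign (a' x) (a x)"
    and "0 \<le> b" and "ext_abs (val a p) \<le> b"
  shows "val a p = val a' p"
proof -
  \<comment> \<open>The two ends must stay apart: \<open>min x b\<close> is \<open>b\<close> if
    \<open>b < x\<close>, but \<open>x\<close> if \<open>x < - b\<close>, so a single class of large
    moduli would not respect the minimum.\<close>
  define R where "R x y \<longleftrightarrow> x = y \<or> b < x \<and> b < y \<or> x < - b \<and> y < - b" for x y
  have neg_b: "- b \<le> 0"
    using assms(2) by (rule uminus_nonpos)
  have "R (val a p) (val a' p)"
  proof (rule val_rel)
    \<comment> \<open>As \<open>- b \<le> 0 \<le> b\<close>, the sign tells which outer class an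
      element of modulus above \<open>b\<close> belongs to.\<close>
    show "R (a x) (a' x)" if "x \<in> vars p" for x
      using assms(1)[OF that] assms(2) neg_b
      by (auto simp: R_def less_ext_abs_iff same_sign_def)
    show "R (- x) (- y)" if "R x y" for x y
      using that by (auto simp: R_def uminus_less_uminus_iff less_uminus_iff[of b])
    \<comment> \<open>Nine cases; when the two outer classes meet, \<open>- b \<le> b\<close> puts
      the lower one entirely below the upper one.\<close>
    show "R (min x x') (min y y')" if "R x y" "R x' y'" for x y x' y'
      using that assms(2) neg_b unfolding R_def by (elim disjE) (auto simp: min_def)
    show "R (max x x') (max y y')" if "R x y" "R x' y'" for x y x' y'
      using that assms(2) neg_b unfolding R_def by (elim disjE) (auto simp: max_def)
  qed
  moreover have "\<not> b < val a p" "\<not> val a p < - b"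
    using assms(3) less_ext_abs_iff[of b "val a p"] by auto
  ultimately show ?thesis
    by (auto simp: R_def)
qed

theorem theorem2:
  fixes \<phi> :: "nat expr"
    and a :: "nat \<Rightarrow> int extended"
    and b :: "int extended"
    and n i r :: nat
  assumes "vars \<phi> \<subseteq> {1..n}"
    and "\<forall>j\<in>{1..n}. a j \<in> Zhat"
    and "1 \<le> i" and "i + r \<le> n"
    and "ext_abs (val a \<phi>) = b" and "ext_abs (a i) = b"
    and "\<forall>j. 1 \<le> j \<and> j + 1 < i \<longrightarrow> ext_abs (a j) \<le> ext_abs (a (j + 1))"
    and "1 < i \<longrightarrow> ext_abs (a (i - 1)) < ext_abs (a i)"
    and "\<forall>j\<in>{i..i + r}. ext_abs (a j) = ext_abs (a i)"
    and "i + r < n \<longrightarrow> ext_abs (a (i + r)) < ext_abs (a (i + r + 1))"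
    and "\<forall>j. i + r < j \<and> j < n \<longrightarrow> ext_abs (a j) \<le> ext_abs (a (j + 1))"
  shows "(\<forall>a'. (\<forall>j\<in>{1..<i}. a' j \<in> Zhat \<and> ext_abs (a' j) < b) \<longrightarrow>
            val a \<phi> = val (\<lambda>j. if j < i then a' j else a j) \<phi>) \<and>
         (\<forall>a'. (\<forall>j\<in>{i + r<..n}. a' j \<in> Zhat \<and> ext_abs (a' j) > b \<and> same_sign (a' j) (a j)) \<longrightarrow>
            val a \<phi> = val (\<lambda>j. if i + r < j then a' j else a j) \<phi>)"
proof (intro conjI allI impI)
  \<comment> \<open>Only neighbours are compared in the hypotheses, so the induction runs downwards
    from \<open>i - 1\<close>, the last index before the strict jump to \<open>b\<close>.\<close>
  have small: "ext_abs (a j) < b" if "1 \<le> j" "j < i" for j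
  proof -
    have "j \<le> i - 1" using that by simp
    then have "ext_abs (a j) \<le> ext_abs (a (i - 1))"
      using that(1)
    proof (induction rule: inc_induct)
      case (step k)
      then have "ext_abs (a k) \<le> ext_abs (a (k + 1))"
        using assms(7) by simp
      with step show ?case by simp
    qed simp
    with that assms(6,8) show ?thesis by simp
  qed
  \<comment> \<open>Dually, the induction runs upwards from \<open>i + r + 1\<close>; carrying
    \<open>j \<le> n\<close> along ensures \<open>k < n\<close> in each step.\<close>
  have large: "b < ext_abs (a j)" if "i + r < j" "j \<le> n" for j
  proof -
    have "i + r + 1 \<le> j" using that by simp
    then have "ext_abs (a (i + r + 1)) \<le> ext_abs (a j)"
      using that(2)
    proof (induction rule: dec_induct)
      case (step k)
      then have "ext_abs (a k) \<le> ext_abs (a (k + 1))"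
        using assms(11) by simp
      with step show ?case by simp
    qed simp
    moreover have "ext_abs (a (i + r)) = b"
      using bspec[OF assms(9), of "i + r"] assms(6) by simp
    ultimately show ?thesis
      using that assms(10) by simp
  qed
  show "val a \<phi> = val (\<lambda>j. if j < i then a' j else a j) \<phi>"
    if "\<forall>j\<in>{1..<i}. a' j \<in> Zhat \<and> ext_abs (a' j) < b" for a'
  proof (rule val_cong_small)
    show "a j = (if j < i then a' j else a j) \<or>
        ext_abs (a j) < b \<and> ext_abs (if j < i then a' j else a j) < b" if "j \<in> vars \<phi>" for j
      \<comment> \<open>The new valuation also uses \<open>a'\<close> at index 0, where it is
        unconstrained; no variable has that index. Indices beyond \<open>n\<close> are excluded
        likewise in the second part.\<close>
      using that \<open>\<forall>j\<in>{1..<i}. _ j\<close> assms(1) small by auto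
    show "b \<le> ext_abs (val a \<phi>)" using assms(5) by simp
  qed
  show "val a \<phi> = val (\<lambda>j. if i + r < j then a' j else a j) \<phi>"
    if "\<forall>j\<in>{i + r<..n}. a' j \<in> Zhat \<and> ext_abs (a' j) > b \<and> same_sign (a' j) (a j)" for a'
  proof (rule val_cong_large)
    show "a j = (if i + r < j then a' j else a j) \<or>
        b < ext_abs (a j) \<and> b < ext_abs (if i + r < j then a' j else a j) \<and>
        same_sign (if i + r < j then a' j else a j) (a j)" if "j \<in> vars \<phi>" for j
      using that \<open>\<forall>j\<in>{i + r<..n}. _ j\<close> assms(1) large by auto
    show "0 \<le> b" using assms(6) ext_abs_nonneg by blast
    show "ext_abs (val a \<phi>) \<le> b" using assms(5) by simp
  qed
qed

end
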